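(* Let $\varepsilon>0$ and let $\alpha=(\alpha_0,\alpha_1,\dots)\in\ell^2$. Suppose $$\sum_{k\ge 0}(k+1)^2\left[\log(k+1)\right]^{2+\varepsilon}|\alpha_k|^2<+\infty.$$ Then the CAR-valued Foguel-Hankel operator $$R(Y_\alpha)=\begin{bmatrix} S^{*(\infty)} & Y_\alpha\\ 0 & S^{(\infty)}\end{bmatrix}$$ is similar to a contraction.
   Context: $H$ is a separable infinite-dimensional complex Hilbert space with inner product $(\cdot,\cdot)$, and $B(H)$ denotes the bounded linear operators on $H$. $\Lambda:H\to B(H)$ is a map satisfying the canonical anticommutation relations (CAR): for all $u,v\in H$, $\Lambda(u)\Lambda(v)+\Lambda(v)\Lambda(u)=0$ and $\Lambda(u)\Lambda(v)^*+\Lambda(v)^*\Lambda(u)=(u,v)I$. $\{e_n\}_{n\ge 0}$ is an orthonormal basis of $H$ and $C_n=\Lambda(e_n)$ for $n\ge 0$. For a sequence $\alpha\in\ell^2$, $Y_\alpha=[\alpha_{i+j}C_{i+j}]_{i,j\ge 0}$ is the CAR-valued Hankel operator acting on $\ell_2(H)$, the Hilbert space of square-summable sequences in $H$ (operator matrices act by $(Xh)_i=\sum_j X_{ij}h_j$). $S^{(\infty)}$ is the unilateral shift on $\ell_2(H)$, $S^{(\infty)}(h_0,h_1,\dots)=(0,h_0,h_1,\dots)$, and $S^{*(\infty)}$ is its adjoint; $R(Y_\alpha)$ acts on $\ell_2(H)\oplus\ell_2(H)$. An operator $T\in B(K)$ is similar to a contraction if there is an invertible $L\in B(K)$ with $\|L^{-1}TL\|\le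 1$. *)

theory Defs
  imports "HOL-Analysis.Analysis"
begin

section \<open>Complex Hilbert spaces\<close>

class complex_vector = real_vector +
  fixes scaleC :: "complex \<Rightarrow> 'a \<Rightarrow> 'a" (infixr \<open>*\<^sub>C\<close> 75)
  assumes scaleC_add_right: "c *\<^sub>C (x + y) = c *\<^sub>C x + c *\<^sub>C y"
    and scaleC_add_left: "(c + d) *\<^sub>C x = c *\<^sub>C x + d *\<^sub>C x"
    and scaleC_scaleC: "c *\<^sub>C d *\<^sub>C x = (c * d) *\<^sub>C x"
    and scaleC_one: "1 *\<^sub>C x = x"
    and scaleR_scaleC: "r *\<^sub>R x = complex_of_real r *\<^sub>C x"

text \<open>The inner product is linear in the first argument. As the norm is already positive
  definite, \<open>cinner_self\<close> gives definiteness of the form and identifies the norm with the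
  induced one.\<close>

class complex_inner = complex_vector + real_normed_vector +
  fixes cinner :: "'a \<Rightarrow> 'a \<Rightarrow> complex"
  assumes cinner_commute: "cinner x y = cnj (cinner y x)"
    and cinner_add_left: "cinner (x + y) z = cinner x z + cinner y z"
    and cinner_scaleC_left: "cinner (c *\<^sub>C x) y = c * cinner x y"
    and cinner_self: "cinner x x = complex_of_real ((norm x)\<^sup>2)"

class chilbert_space = complex_inner + complete_space

instance chilbert_space \<subseteq> banach ..

global_interpretation complex_vector: vector_space "scaleC :: complex \<Rightarrow> 'a \<Rightarrow> 'a::complex_vector"
  by unfold_locales (simp_all add: scaleC_add_right scaleC_add_left scaleC_scaleC scaleC_one)

lemma norm_scaleC: "norm (c *\<^sub>C x) = cmod c * norm (x :: 'a::complex_inner)"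
proof -
  have "cinner (c *\<^sub>C x) (c *\<^sub>C x) = c * cnj (c * cinner x x)"
    by (metis cinner_commute cinner_scaleC_left)
  also have "\<dots> = (c * cnj c) * complex_of_real ((norm x)\<^sup>2)"
    by (simp add: cinner_self)
  also have "\<dots> = complex_of_real ((cmod c * norm x)\<^sup>2)"
    by (simp add: complex_norm_square[symmetric] power_mult_distrib)
  finally have "(norm (c *\<^sub>C x))\<^sup>2 = (cmod c * norm x)\<^sup>2"
    unfolding cinner_self of_real_eq_iff .
  then show ?thesis by (simp add: power2_eq_iff_nonneg)
qed

lemma cinner_add_right: "cinner x (y + z) = cinner x y + cinner x (z :: 'a::complex_inner)"
  by (metis cinner_commute cinner_add_left complex_cnj_add)

lemma Re_cinner_le_norm: "Re (cinner x y) \<le> norm x * norm (y :: 'a::complex_inner)"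
proof -
  have "cinner (x + y) (x + y) = cinner x x + cinner y y + (cinner x y + cnj (cinner x y))"
    by (simp add: cinner_add_left cinner_add_right cinner_commute[of y x])
  then have "Re (cinner (x + y) (x + y)) = (norm x)\<^sup>2 + (norm y)\<^sup>2 + 2 * Re (cinner x y)"
    by (simp add: cinner_self)
  then have "(norm (x + y))\<^sup>2 = (norm x)\<^sup>2 + (norm y)\<^sup>2 + 2 * Re (cinner x y)"
    by (simp add: cinner_self)
  moreover have "(norm (x + y))\<^sup>2 \<le> (norm x + norm y)\<^sup>2"
    by (intro power_mono norm_triangle_ineq) auto
  ultimately show ?thesis by (simp add: power2_eq_square algebra_simps)
qed

lemma norm_cinner_le_norm: "cmod (cinner x y) \<le> norm x * norm (y :: 'a::complex_inner)"
proof (cases "cinner x y = 0")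
  case False
  define u where "u = cnj (sgn (cinner x y))"
  have u: "cmod u = 1" using False by (simp add: u_def norm_sgn)
  have "u * cinner x y = complex_of_real (cmod (cinner x y))"
  proof -
    have "u * cinner x y = (cinner x y * cnj (cinner x y)) / complex_of_real (cmod (cinner x y))"
      by (simp add: u_def sgn_eq)
    also have "\<dots> = complex_of_real (cmod (cinner x y))"
      using False by (simp add: complex_norm_square[symmetric] power2_eq_square)
    finally show ?thesis .
  qed
  then have "cmod (cinner x y) = Re (cinner (u *\<^sub>C x) y)"
    by (simp add: cinner_scaleC_left)
  also have "\<dots> \<le> norm (u *\<^sub>C x) * norm y" by (rule Re_cinner_le_norm)
  finally show ?thesis by (simp add: norm_scaleC u)
qed simp

instantiation prod :: (complex_vector, complex_vector) complex_vector
begin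
definition "c *\<^sub>C p = (c *\<^sub>C fst p, c *\<^sub>C snd p)"
instance
  by standard (auto simp: scaleC_prod_def scaleC_add_right scaleC_add_left scaleC_scaleC
      scaleC_one scaleR_scaleC prod_eq_iff)
end

instantiation prod :: (complex_inner, complex_inner) complex_inner
begin
definition "cinner p q = cinner (fst p) (fst q) + cinner (snd p) (snd q)"
instance
proof
  fix p q r :: "'a \<times> 'b" and c :: complex
  show "cinner p q = cnj (cinner q p)"
    unfolding cinner_prod_def by (metis cinner_commute complex_cnj_add)
  show "cinner (p + q) r = cinner p r + cinner q r"
    by (simp add: cinner_prod_def cinner_add_left)
  show "cinner (c *\<^sub>C p) q = c * cinner p q"
    by (simp add: cinner_prod_def scaleC_prod_def cinner_scaleC_left algebra_simps)
  show "cinner p p = complex_of_real ((norm p)\<^sup>2)"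
    by (simp add: cinner_prod_def cinner_self norm_prod_def)
qed
end

instance prod :: (chilbert_space, chilbert_space) chilbert_space ..

section \<open>Bounded operators\<close>

text \<open>\<open>B(H)\<close> consists of the functions satisfying this predicate; \<open>onorm\<close> is the
  operator norm.\<close>

definition bounded_clinear :: "('a::complex_inner \<Rightarrow> 'b::complex_inner) \<Rightarrow> bool"
  where "bounded_clinear T \<longleftrightarrow> bounded_linear T \<and> (\<forall>c x. T (c *\<^sub>C x) = c *\<^sub>C T x)"

text \<open>On a Hilbert space the adjoint of a bounded operator exists by the Riesz theorem, and it is
  unique; the description is meaningful only there.\<close>

definition cadjoint :: "('a::complex_inner \<Rightarrow> 'b::complex_inner) \<Rightarrow> 'b \<Rightarrow> 'a"
  where "cadjoint T = (THE T'. \<forall>x y. cinner (T x) y = cinner x (T' y))"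

definition similar_to_contraction :: "('a::chilbert_space \<Rightarrow> 'a) \<Rightarrow> bool"
  where "similar_to_contraction T \<longleftrightarrow> bounded_clinear T \<and>
    (\<exists>L L' :: 'a \<Rightarrow> 'a. bounded_clinear L \<and> bounded_clinear L' \<and> L \<circ> L' = id \<and> L' \<circ> L = id \<and>
       onorm (L' \<circ> T \<circ> L) \<le> 1)"

definition orthonormal_basis :: "(nat \<Rightarrow> 'a::complex_inner) \<Rightarrow> bool"
  where "orthonormal_basis e \<longleftrightarrow> (\<forall>m n. cinner (e m) (e n) = (if m = n then 1 else 0)) \<and>
    closure (complex_vector.span (range e)) = UNIV"

section \<open>The space of square-summable sequences\<close>

typedef (overloaded) 'a ell2 = "{h :: nat \<Rightarrow> 'a::real_normed_vector. summable (\<lambda>n. (norm (h n))\<^sup>2)}"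
  morphisms seq Abs_ell2
proof
  show "(\<lambda>n. 0) \<in> {h :: nat \<Rightarrow> 'a. summable (\<lambda>n. (norm (h n))\<^sup>2)}" by simp
qed

setup_lifting type_definition_ell2

lemma summable_seq: "summable (\<lambda>n. (norm (seq h n))\<^sup>2)"
  using seq[of h] by simp

lemma ell2_eqI: "(\<And>n. seq g n = seq h n) \<Longrightarrow> g = h"
  by (metis ext seq_inject)

lemma sum_sq_bound: "norm (x + y :: 'a::real_normed_vector) ^ 2 \<le> 2 * (norm x)\<^sup>2 + 2 * (norm y)\<^sup>2"
proof -
  have "norm (x + y) ^ 2 \<le> (norm x + norm y)\<^sup>2"
    by (intro power_mono norm_triangle_ineq) auto
  also have "\<dots> \<le> 2 * (norm x)\<^sup>2 + 2 * (norm y)\<^sup>2"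
    using sum_squares_bound[of "norm x" "norm y"] by (simp add: power2_sum)
  finally show ?thesis .
qed

lemma ell2_add_closed:
  fixes f g :: "nat \<Rightarrow> 'a::real_normed_vector"
  assumes "summable (\<lambda>n. (norm (f n))\<^sup>2)" "summable (\<lambda>n. (norm (g n))\<^sup>2)"
  shows "summable (\<lambda>n. (norm (f n + g n))\<^sup>2)"
proof (rule summable_comparison_test'[where N = 0])
  show "summable (\<lambda>n. 2 * (norm (f n))\<^sup>2 + 2 * (norm (g n))\<^sup>2)"
    using assms by (intro summable_add summable_mult)
  show "norm ((norm (f n + g n))\<^sup>2) \<le> 2 * (norm (f n))\<^sup>2 + 2 * (norm (g n))\<^sup>2" for n
    using sum_sq_bound[of "f n" "g n"] by simp
qed

lemma ell2_diff_closed: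
  fixes f g :: "nat \<Rightarrow> 'a::real_normed_vector"
  assumes "summable (\<lambda>n. (norm (f n))\<^sup>2)" "summable (\<lambda>n. (norm (g n))\<^sup>2)"
  shows "summable (\<lambda>n. (norm (f n - g n))\<^sup>2)"
  using ell2_add_closed[of f "\<lambda>n. - g n"] assms by simp

instantiation ell2 :: (real_normed_vector) real_vector
begin
lift_definition zero_ell2 :: "'a ell2" is "\<lambda>n. 0" by simp
lift_definition plus_ell2 :: "'a ell2 \<Rightarrow> 'a ell2 \<Rightarrow> 'a ell2" is "\<lambda>f g n. f n + g n"
  by (rule ell2_add_closed)
lift_definition minus_ell2 :: "'a ell2 \<Rightarrow> 'a ell2 \<Rightarrow> 'a ell2" is "\<lambda>f g n. f n - g n"
  by (rule ell2_diff_closed)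
lift_definition uminus_ell2 :: "'a ell2 \<Rightarrow> 'a ell2" is "\<lambda>f n. - f n" by simp
lift_definition scaleR_ell2 :: "real \<Rightarrow> 'a ell2 \<Rightarrow> 'a ell2" is "\<lambda>r f n. r *\<^sub>R f n"
  by (simp add: power_mult_distrib summable_mult)
instance
  by standard (transfer; simp add: algebra_simps fun_eq_iff)+
end

instantiation ell2 :: (real_normed_vector) real_normed_vector
begin
definition norm_ell2 :: "'a ell2 \<Rightarrow> real"
  where "norm_ell2 h = sqrt (\<Sum>n. (norm (seq h n))\<^sup>2)"
definition dist_ell2 :: "'a ell2 \<Rightarrow> 'a ell2 \<Rightarrow> real" where "dist_ell2 g h = norm (g - h)"
definition sgn_ell2 :: "'a ell2 \<Rightarrow> 'a ell2" where "sgn_ell2 h = h /\<^sub>R norm h"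
definition uniformity_ell2 :: "('a ell2 \<times> 'a ell2) filter"
  where "uniformity_ell2 = (INF e\<in>{0 <..}. principal {(x :: 'a ell2, y). dist x y < e})"
definition open_ell2 :: "'a ell2 set \<Rightarrow> bool"
  where "open_ell2 U = (\<forall>x\<in>U. \<forall>\<^sub>F (x', y) in uniformity. x' = x \<longrightarrow> y \<in> U)"
instance
proof
  fix f g :: "'a ell2" and r :: real and U :: "'a ell2 set"
  show "dist f g = norm (f - g)" by (rule dist_ell2_def)
  show "sgn f = f /\<^sub>R norm f" by (rule sgn_ell2_def)
  show "(uniformity :: ('a ell2 \<times> 'a ell2) filter) =
      (INF e\<in>{0 <..}. principal {(x, y). dist x y < e})"
    by (rule uniformity_ell2_def)
  show "open U = (\<forall>x\<in>U. \<forall>\<^sub>F (x', y) in uniformity. x' = x \<longrightarrow> y \<in> U)"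
    by (rule open_ell2_def)
  show "(norm f = 0) = (f = 0)"
  proof
    assume "norm f = 0"
    then have "(\<Sum>n. (norm (seq f n))\<^sup>2) = 0" by (simp add: norm_ell2_def)
    then have "\<forall>n. (norm (seq f n))\<^sup>2 = 0"
      by (subst (asm) suminf_eq_zero_iff) (auto simp: summable_seq)
    then show "f = 0" by (intro ell2_eqI) (simp add: zero_ell2.rep_eq)
  qed (simp add: norm_ell2_def zero_ell2.rep_eq)
  show "norm (r *\<^sub>R f) = \<bar>r\<bar> * norm f"
    by (simp add: norm_ell2_def scaleR_ell2.rep_eq power_mult_distrib suminf_mult summable_seq
        real_sqrt_mult)
  show "norm (f + g) \<le> norm f + norm g"
  proof -
    have part: "L2_set (\<lambda>n. norm (seq h n)) {..<N} \<le> norm h" for h :: "'a ell2" and N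
      unfolding L2_set_def norm_ell2_def
      by (intro real_sqrt_le_mono sum_le_suminf summable_seq) auto
    have "(\<Sum>n<N. (norm (seq (f + g) n))\<^sup>2) \<le> (norm f + norm g)\<^sup>2" for N
    proof -
      have "L2_set (\<lambda>n. norm (seq (f + g) n)) {..<N}
          \<le> L2_set (\<lambda>n. norm (seq f n) + norm (seq g n)) {..<N}"
        by (intro L2_set_mono) (auto simp: plus_ell2.rep_eq norm_triangle_ineq)
      also have "\<dots> \<le> L2_set (\<lambda>n. norm (seq f n)) {..<N} + L2_set (\<lambda>n. norm (seq g n)) {..<N}"
        by (rule L2_set_triangle_ineq)
      also have "\<dots> \<le> norm f + norm g" by (intro add_mono part)
      finally have "(L2_set (\<lambda>n. norm (seq (f + g) n)) {..<N})\<^sup>2 \<le> (norm f + norm g)\<^sup>2"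
        by (intro power_mono) auto
      then show ?thesis by (simp add: L2_set_def sum_nonneg)
    qed
    then have "(\<Sum>n. (norm (seq (f + g) n))\<^sup>2) \<le> (norm f + norm g)\<^sup>2"
      by (intro suminf_le_const summable_seq)
    moreover have "0 \<le> norm f + norm g"
      by (auto simp: norm_ell2_def intro!: add_nonneg_nonneg suminf_nonneg summable_seq)
    ultimately show ?thesis
      unfolding norm_ell2_def[of "f + g"] by (rule real_le_lsqrt[rotated])
  qed
qed
end

lemma sum_seq_le: "(\<Sum>n<N. (norm (seq h n))\<^sup>2) \<le> (norm h)\<^sup>2"
proof -
  have "(\<Sum>n<N. (norm (seq h n))\<^sup>2) \<le> (\<Sum>n. (norm (seq h n))\<^sup>2)"
    by (intro sum_le_suminf summable_seq) auto
  then show ?thesis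
    by (simp add: norm_ell2_def suminf_nonneg summable_seq)
qed

lemma norm_seq_le: "norm (seq h n) \<le> norm h"
proof -
  have "(norm (seq h n))\<^sup>2 = (\<Sum>k\<in>{n}. (norm (seq h k))\<^sup>2)" by simp
  also have "\<dots> \<le> (\<Sum>k. (norm (seq h k))\<^sup>2)"
    by (intro sum_le_suminf summable_seq) auto
  finally show ?thesis unfolding norm_ell2_def by (rule real_le_rsqrt)
qed

instance ell2 :: (banach) banach
proof
  fix X :: "nat \<Rightarrow> 'a ell2"
  assume "Cauchy X"
  have "Cauchy (\<lambda>k. seq (X k) n)" for n
  proof (rule metric_CauchyI)
    fix r :: real assume "r > 0"
    then obtain M where "\<forall>m\<ge>M. \<forall>k\<ge>M. dist (X m) (X k) < r"
      using \<open>Cauchy X\<close> by (auto simp: Cauchy_def)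
    moreover have "dist (seq (X m) n) (seq (X k) n) \<le> dist (X m) (X k)" for m k
      using norm_seq_le[of "X m - X k" n] by (simp add: dist_norm minus_ell2.rep_eq)
    ultimately show "\<exists>M. \<forall>m\<ge>M. \<forall>k\<ge>M. dist (seq (X m) n) (seq (X k) n) < r"
      by (meson le_less_trans)
  qed
  then have "\<exists>l. (\<lambda>k. seq (X k) n) \<longlonglongrightarrow> l" for n
    by (simp add: Cauchy_convergent convergentD)
  then obtain f where f: "\<And>n. (\<lambda>k. seq (X k) n) \<longlonglongrightarrow> f n" by metis
  have bound: "(\<Sum>n<N. (norm (seq (X m) n - f n))\<^sup>2) \<le> r\<^sup>2"
    if "\<forall>k\<ge>M. dist (X m) (X k) < r" "r > 0" for m M N r
  proof (rule LIMSEQ_le_const2)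
    show "(\<lambda>k. \<Sum>n<N. (norm (seq (X m) n - seq (X k) n))\<^sup>2)
        \<longlonglongrightarrow> (\<Sum>n<N. (norm (seq (X m) n - f n))\<^sup>2)"
      by (intro tendsto_intros f)
    have "(\<Sum>n<N. (norm (seq (X m) n - seq (X k) n))\<^sup>2) \<le> r\<^sup>2" if "k \<ge> M" for k
    proof -
      have "(\<Sum>n<N. (norm (seq (X m) n - seq (X k) n))\<^sup>2) \<le> (norm (X m - X k))\<^sup>2"
        using sum_seq_le[of "X m - X k" N] by (simp add: minus_ell2.rep_eq)
      also have "\<dots> \<le> r\<^sup>2"
        using \<open>\<forall>k\<ge>M. dist (X m) (X k) < r\<close> that by (intro power_mono) (auto simp: dist_norm less_imp_le)
      finally show ?thesis .
    qed
    then show "\<exists>K. \<forall>k\<ge>K. (\<Sum>n<N. (norm (seq (X m) n - seq (X k) n))\<^sup>2) \<le> r\<^sup>2" by blast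
  qed
  have diff: "summable (\<lambda>n. (norm (seq (X m) n - f n))\<^sup>2)"
    if "\<forall>k\<ge>M. dist (X m) (X k) < r" "r > 0" for m M r
    by (rule bounded_imp_summable[where B = "r\<^sup>2"])
      (use bound[OF that, of "Suc _"] in \<open>auto simp: lessThan_Suc_atMost\<close>)
  obtain M where M: "\<forall>m\<ge>M. \<forall>k\<ge>M. dist (X m) (X k) < 1"
    using \<open>Cauchy X\<close> unfolding Cauchy_def by (meson zero_less_one)
  have "summable (\<lambda>n. (norm (seq (X M) n - (seq (X M) n - f n)))\<^sup>2)"
    by (intro ell2_diff_closed summable_seq diff[of M _ 1]) (use M in auto)
  then have fl: "summable (\<lambda>n. (norm (f n))\<^sup>2)" by simp
  then have seq_f: "seq (Abs_ell2 f) = f" by (simp add: Abs_ell2_inverse)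
  have "X \<longlonglongrightarrow> Abs_ell2 f"
  proof (rule metric_LIMSEQ_I)
    fix r :: real assume "r > 0"
    then have r2: "r / 2 > 0" by simp
    obtain K where K: "\<forall>m\<ge>K. \<forall>k\<ge>K. dist (X m) (X k) < r / 2"
      using \<open>Cauchy X\<close> r2 unfolding Cauchy_def by meson
    have "dist (X m) (Abs_ell2 f) < r" if "m \<ge> K" for m
    proof -
      have Km: "\<forall>k\<ge>K. dist (X m) (X k) < r / 2" using K that by blast
      have "(\<Sum>n. (norm (seq (X m) n - f n))\<^sup>2) \<le> (r / 2)\<^sup>2"
        by (intro suminf_le_const diff[OF Km r2] bound[OF Km r2])
      then have "dist (X m) (Abs_ell2 f) \<le> r / 2"
        unfolding dist_norm norm_ell2_def minus_ell2.rep_eq seq_f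
        using r2 by (intro real_le_lsqrt) auto
      then show ?thesis using \<open>r > 0\<close> by simp
    qed
    then show "\<exists>K. \<forall>m\<ge>K. dist (X m) (Abs_ell2 f) < r" by blast
  qed
  then show "convergent X" by (rule convergentI)
qed

instantiation ell2 :: (complex_inner) complex_vector
begin
lift_definition scaleC_ell2 :: "complex \<Rightarrow> 'a ell2 \<Rightarrow> 'a ell2" is "\<lambda>c f n. c *\<^sub>C f n"
  by (simp add: norm_scaleC power_mult_distrib summable_mult)
instance
  by standard
    (transfer; simp add: scaleC_add_right scaleC_add_left scaleC_scaleC scaleC_one scaleR_scaleC)+
end

lemma summable_cinner_seq: "summable (\<lambda>n. cinner (seq g n) (seq h n))"
proof (rule summable_comparison_test'[where N = 0])
  show "summable (\<lambda>n. (norm (seq g n))\<^sup>2 + (norm (seq h n))\<^sup>2)"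
    by (intro summable_add summable_seq)
  show "norm (cinner (seq g n) (seq h n)) \<le> (norm (seq g n))\<^sup>2 + (norm (seq h n))\<^sup>2" for n
  proof -
    have "norm (cinner (seq g n) (seq h n)) \<le> norm (seq g n) * norm (seq h n)"
      by (rule norm_cinner_le_norm)
    also have "\<dots> \<le> 2 * norm (seq g n) * norm (seq h n)"
      by simp
    also have "\<dots> \<le> (norm (seq g n))\<^sup>2 + (norm (seq h n))\<^sup>2"
      by (rule sum_squares_bound)
    finally show ?thesis .
  qed
qed

instantiation ell2 :: (complex_inner) complex_inner
begin
definition cinner_ell2 :: "'a ell2 \<Rightarrow> 'a ell2 \<Rightarrow> complex"
  where "cinner_ell2 g h = (\<Sum>n. cinner (seq g n) (seq h n))"
instance
proof
  fix f g h :: "'a ell2" and c :: complex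
  show "cinner f g = cnj (cinner g f)"
  proof -
    have "(\<lambda>n. cnj (cinner (seq g n) (seq f n))) sums cnj (cinner g f)"
      unfolding cinner_ell2_def sums_cnj by (rule summable_sums[OF summable_cinner_seq])
    then show ?thesis
      unfolding cinner_ell2_def[of f g] by (simp add: sums_iff cinner_commute[symmetric])
  qed
  show "cinner (f + g) h = cinner f h + cinner g h"
    by (simp add: cinner_ell2_def plus_ell2.rep_eq cinner_add_left suminf_add summable_cinner_seq)
  show "cinner (c *\<^sub>C f) g = c * cinner f g"
    by (simp add: cinner_ell2_def scaleC_ell2.rep_eq cinner_scaleC_left suminf_mult
        summable_cinner_seq)
  have "0 \<le> (\<Sum>n. (norm (seq f n))\<^sup>2)" by (intro suminf_nonneg summable_seq) auto
  then show "cinner f f = complex_of_real ((norm f)\<^sup>2)"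
    by (simp add: cinner_ell2_def norm_ell2_def cinner_self suminf_of_real summable_seq
        del: of_real_power)
qed
end

instance ell2 :: (chilbert_space) chilbert_space ..

section \<open>The CAR-valued Foguel-Hankel operator\<close>

definition car_map :: "('h::chilbert_space \<Rightarrow> 'h \<Rightarrow> 'h) \<Rightarrow> bool"
  where "car_map \<Lambda> \<longleftrightarrow> (\<forall>u. bounded_clinear (\<Lambda> u)) \<and>
    (\<forall>u v x. \<Lambda> u (\<Lambda> v x) + \<Lambda> v (\<Lambda> u x) = 0) \<and>
    (\<forall>u v x. \<Lambda> u (cadjoint (\<Lambda> v) x) + cadjoint (\<Lambda> v) (\<Lambda> u x) = cinner u v *\<^sub>C x)"

lift_definition shift :: "'h::real_normed_vector ell2 \<Rightarrow> 'h ell2"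
  is "\<lambda>h n. case n of 0 \<Rightarrow> 0 | Suc m \<Rightarrow> h m"
  by (subst summable_Suc_iff[symmetric]) simp

text \<open>An infinite operator matrix acts by \<open>(X h)\<^sub>i = (\<Sum>j. X\<^sub>i\<^sub>j h\<^sub>j)\<close>. This need not make sense for
  every matrix: \<open>matrix_acts\<close> states that all these series converge and that the result is
  square-summable, and \<open>matrix_op\<close> is unspecified where this fails.\<close>

definition matrix_acts :: "(nat \<Rightarrow> nat \<Rightarrow> 'h::real_normed_vector \<Rightarrow> 'h) \<Rightarrow> bool"
  where "matrix_acts X \<longleftrightarrow> (\<forall>h. (\<forall>i. summable (\<lambda>j. X i j (seq h j))) \<and>
    summable (\<lambda>i. (norm (\<Sum>j. X i j (seq h j)))\<^sup>2))"

definition matrix_op :: "(nat \<Rightarrow> nat \<Rightarrow> 'h::real_normed_vector \<Rightarrow> 'h) \<Rightarrow> 'h ell2 \<Rightarrow> 'h ell2"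
  where "matrix_op X h = Abs_ell2 (\<lambda>i. \<Sum>j. X i j (seq h j))"

definition car_hankel_matrix ::
    "('h::chilbert_space \<Rightarrow> 'h \<Rightarrow> 'h) \<Rightarrow> (nat \<Rightarrow> 'h) \<Rightarrow> (nat \<Rightarrow> complex) \<Rightarrow> nat \<Rightarrow> nat \<Rightarrow> 'h \<Rightarrow> 'h"
  where "car_hankel_matrix \<Lambda> e \<alpha> i j = (\<lambda>x. \<alpha> (i + j) *\<^sub>C \<Lambda> (e (i + j)) x)"

definition foguel_op :: "('h::chilbert_space ell2 \<Rightarrow> 'h ell2) \<Rightarrow> 'h ell2 \<times> 'h ell2 \<Rightarrow> 'h ell2 \<times> 'h ell2"
  where "foguel_op Y = (\<lambda>(g, h). (cadjoint shift g + Y h, shift h))"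

end

theory Submission
  imports Defs
begin

text \<open>Write \<open>S\<close> for the shift on \<open>\<ell>\<^sub>2(H)\<close>, \<open>Y\<close> for the Hankel operator and \<open>C\<^sub>n = \<Lambda>(e\<^sub>n)\<close>. If a bounded
  operator \<open>X\<close> solves the commutator equation \<open>Y = X S - S\<^sup>* X\<close>, then the unipotent matrix with
  corner \<open>X\<close> conjugates \<open>R(Y)\<close> to the contraction \<open>S\<^sup>* \<oplus> S\<close>
  (lemma \<open>foguel_similar_to_contraction\<close>). On matrices the equation says
  \<open>X\<^sub>i\<^sub>,\<^sub>j\<^sub>+\<^sub>1 - X\<^sub>i\<^sub>+\<^sub>1\<^sub>,\<^sub>j = \<alpha>\<^sub>i\<^sub>+\<^sub>j C\<^sub>i\<^sub>+\<^sub>j\<close>, and it has the solution \<open>X\<^sub>i\<^sub>j = j \<alpha>\<^sub>i\<^sub>+\<^sub>j\<^sub>-\<^sub>1 C\<^sub>i\<^sub>+\<^sub>j\<^sub>-\<^sub>1\<close>, that is,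
  \<open>X = Z S\<^sup>*\<close> with \<open>Z\<^sub>i\<^sub>j = (j + 1) \<alpha>\<^sub>i\<^sub>+\<^sub>j C\<^sub>i\<^sub>+\<^sub>j\<close>. Everything rests on the boundedness of \<open>Z\<close>.

  The anticommutation relations give the norm of a Hankel operator with coefficients \<open>\<beta>\<^sub>n C\<^sub>n\<close>:
  extended to an operator \<open>T = \<Sum>\<^sub>n \<beta>\<^sub>n C\<^sub>n \<otimes> \<Gamma>\<^sub>n\<close> on sequences indexed by all the integers, where
  \<open>\<Gamma>\<^sub>n\<close> is the reflection \<open>i \<mapsto> n - i\<close>, it satisfies \<open>T\<^sup>* T \<le> (\<Sum>\<^sub>n |\<beta>\<^sub>n|\<^sup>2) I\<close>
  (lemma \<open>car_hankel_int\<close>). Hence the columns \<open>j \<ge> p\<close> of \<open>Y\<close> form an operator of squared norm at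
  most \<open>\<Sum>\<^sub>n\<^sub>\<ge>\<^sub>p |\<alpha>\<^sub>n|\<^sup>2\<close>. Cut \<open>Z\<close> into the blocks of columns with \<open>2\<^sup>m \<le> j + 1 < 2\<^sup>m\<^sup>+\<^sup>1\<close>. The
  factor \<open>j + 1\<close> is a right multiplication by a diagonal operator, and costs at most \<open>2\<^sup>m\<^sup>+\<^sup>1\<close> on
  this block. As the blocks live on orthogonal subspaces, their squared norms add up:
  \<open>\<parallel>Z\<parallel>\<^sup>2 \<le> \<Sum>\<^sub>m 4\<^sup>m\<^sup>+\<^sup>1 \<Sum>\<^sub>n |\<alpha>\<^sub>n|\<^sup>2 [n + 1 \<ge> 2\<^sup>m] \<le> 6 \<Sum>\<^sub>n (n + 1)\<^sup>2 |\<alpha>\<^sub>n|\<^sup>2\<close>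
  (lemma \<open>weighted_car_hankel_section\<close>). The last sum is finite, because the logarithmic factor
  in the hypothesis is at least \<open>1\<close> from \<open>k = 2\<close> on.\<close>

section \<open>Inner product and bounded operators\<close>

lemma cinner_scaleC_right: "cinner x (c *\<^sub>C y) = cnj c * cinner x (y :: 'a::complex_inner)"
  by (metis cinner_commute cinner_scaleC_left complex_cnj_mult)

lemma cinner_zero_left [simp]: "cinner 0 (y :: 'a::complex_inner) = 0"
  using cinner_add_left[of 0 0 y] by simp

lemma cinner_zero_right [simp]: "cinner (x :: 'a::complex_inner) 0 = 0"
  using cinner_add_right[of x 0 0] by simp

lemma cinner_minus_left: "cinner (x - y) z = cinner x z - cinner y (z :: 'a::complex_inner)"
  using cinner_add_left[of "x - y" y z] by simp

lemma cinner_minus_right: "cinner x (y - z) = cinner x y - cinner x (z :: 'a::complex_inner)"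
  using cinner_add_right[of x "y - z" z] by simp

lemma cinner_sum_left: "cinner (\<Sum>i\<in>I. f i) y = (\<Sum>i\<in>I. cinner (f i) (y :: 'a::complex_inner))"
  by (induction I rule: infinite_finite_induct) (auto simp: cinner_add_left)

lemma cinner_sum_right: "cinner x (\<Sum>i\<in>I. f i) = (\<Sum>i\<in>I. cinner (x :: 'a::complex_inner) (f i))"
  by (induction I rule: infinite_finite_induct) (auto simp: cinner_add_right)

lemma cinner_eq_zero: "cinner x (x :: 'a::complex_inner) = 0 \<longleftrightarrow> x = 0"
  by (simp add: cinner_self)

lemma cinner_ext_right:
  assumes "\<And>x. cinner x y = cinner x (z :: 'a::complex_inner)"
  shows "y = z"
proof -
  have "cinner (y - z) (y - z) = 0"
    using assms[of "y - z"] by (simp add: cinner_minus_right)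
  then show ?thesis by (simp add: cinner_eq_zero)
qed

lemma norm_sq_add:
  "(norm (x + y :: 'a::complex_inner))\<^sup>2 = (norm x)\<^sup>2 + (norm y)\<^sup>2 + 2 * Re (cinner x y)"
proof -
  have "complex_of_real ((norm (x + y))\<^sup>2) = cinner x x + cinner y y + (cinner x y + cnj (cinner x y))"
    by (simp add: cinner_self[symmetric] cinner_add_left cinner_add_right cinner_commute[of y x]
        del: of_real_power)
  then have "Re (complex_of_real ((norm (x + y))\<^sup>2))
      = Re (cinner x x + cinner y y + (cinner x y + cnj (cinner x y)))"
    by (rule arg_cong)
  then show ?thesis by (simp add: cinner_self)
qed

lemma cadjoint_eqI:
  assumes "\<And>x y. cinner (T x) y = cinner (x :: 'a::complex_inner) (T' (y :: 'b::complex_inner))"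
  shows "cadjoint T = T'"
  unfolding cadjoint_def
proof (rule the_equality)
  show "\<forall>x y. cinner (T x) y = cinner x (T' y)" using assms by blast
next
  fix U assume U: "\<forall>x y. cinner (T x) y = cinner x (U y)"
  show "U = T'"
  proof
    fix y show "U y = T' y"
      by (rule cinner_ext_right) (use U assms in metis)
  qed
qed

lemma bounded_clinearD:
  assumes "bounded_clinear T"
  shows "bounded_linear T" "T (x + y) = T x + T y" "T (x - y) = T x - T y" "T 0 = 0"
    "T (c *\<^sub>C x) = c *\<^sub>C T x" "T (sum f I) = (\<Sum>i\<in>I. T (f i))"
  using assms linear_sum[of T f I]
  by (auto simp: bounded_clinear_def bounded_linear.linear linear_add linear_diff linear_0)

lemma bounded_clinearI:
  assumes "\<And>x y. T (x + y) = T x + T y" "\<And>c x. T (c *\<^sub>C x) = c *\<^sub>C T x"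
    and "\<And>x. norm (T x) \<le> K * norm x"
  shows "bounded_clinear T"
  unfolding bounded_clinear_def
proof
  show "bounded_linear T"
    by (rule bounded_linear_intro[where K = K])
      (use assms in \<open>auto simp: scaleR_scaleC mult.commute\<close>)
qed (use assms(2) in blast)

lemma bounded_clinear_compose:
  assumes "bounded_clinear f" "bounded_clinear g"
  shows "bounded_clinear (\<lambda>x. f (g x))"
  using assms bounded_linear_compose[of f g] unfolding bounded_clinear_def by auto

lemma bounded_clinear_add:
  assumes "bounded_clinear f" "bounded_clinear g"
  shows "bounded_clinear (\<lambda>x. f x + g x)"
  using assms bounded_linear_add[of f g] unfolding bounded_clinear_def by (auto simp: scaleC_add_right)

lemma bounded_clinear_diff:
  assumes "bounded_clinear f" "bounded_clinear g"
  shows "bounded_clinear (\<lambda>x. f x - g x)"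
  using assms bounded_linear_sub[of f g] unfolding bounded_clinear_def
  by (auto simp: complex_vector.scale_right_diff_distrib)

lemma bounded_clinear_Pair:
  assumes "bounded_clinear f" "bounded_clinear g"
  shows "bounded_clinear (\<lambda>x. (f x, g x))"
  using assms bounded_linear_Pair[of f g] unfolding bounded_clinear_def by (auto simp: scaleC_prod_def)

lemma bounded_clinear_fst: "bounded_clinear fst"
  unfolding bounded_clinear_def by (auto simp: scaleC_prod_def bounded_linear_fst)

lemma bounded_clinear_snd: "bounded_clinear snd"
  unfolding bounded_clinear_def by (auto simp: scaleC_prod_def bounded_linear_snd)

section \<open>Adjoints exist\<close>

text \<open>The representing vector minimises \<open>J x = \<parallel>x\<parallel>\<^sup>2 - 2 Re (\<phi> x)\<close>: the parallelogram law makes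
  minimising sequences Cauchy, and at a minimum the derivative of \<open>J\<close> in every direction vanishes,
  which says \<open>Re (\<phi> x) = Re (cinner x y)\<close>; multiplying \<open>x\<close> by \<open>\<i>\<close> gives the imaginary part.\<close>

lemma riesz_representation:
  fixes \<phi> :: "'h::chilbert_space \<Rightarrow> complex"
  assumes lin: "\<And>x y. \<phi> (x + y) = \<phi> x + \<phi> y" "\<And>c x. \<phi> (c *\<^sub>C x) = c * \<phi> x"
    and bound: "\<And>x. cmod (\<phi> x) \<le> K * norm x"
  shows "\<exists>y. \<forall>x. \<phi> x = cinner x y"
proof -
  define J where "J x = (norm x)\<^sup>2 - 2 * Re (\<phi> x)" for x
  define d where "d = Inf (range J)"
  have J_ge: "J x \<ge> - (K\<^sup>2)" for x
  proof -
    have "Re (\<phi> x) \<le> K * norm x"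
      using bound[of x] complex_Re_le_cmod[of "\<phi> x"] by linarith
    moreover have "0 \<le> (norm x - K)\<^sup>2" by simp
    ultimately show ?thesis by (simp add: J_def power2_diff mult.commute)
  qed
  have bdd: "bdd_below (range J)" using J_ge by (intro bdd_belowI) auto
  have d_le: "d \<le> J x" for x unfolding d_def by (intro cInf_lower bdd) auto
  have phi_R: "\<phi> (r *\<^sub>R x) = r *\<^sub>R \<phi> x" for r x
    by (simp add: scaleR_scaleC lin scaleR_conv_of_real)
  have bl: "bounded_linear \<phi>"
    by (rule bounded_linear_intro[where K = K]) (use lin phi_R bound in \<open>auto simp: mult.commute\<close>)
  have J_line: "J (y + t *\<^sub>R x) = J y + t * (2 * (Re (cinner x y) - Re (\<phi> x))) + t\<^sup>2 * (norm x)\<^sup>2" for x y t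
  proof -
    have "Re (cinner y (t *\<^sub>R x)) = t * Re (cinner x y)"
      by (simp add: scaleR_scaleC cinner_scaleC_right cinner_commute[of y x])
    then show ?thesis
      by (simp add: J_def norm_sq_add lin phi_R power_mult_distrib algebra_simps)
  qed
  have midpoint: "(norm (x - y))\<^sup>2 \<le> 2 * (J x - d) + 2 * (J y - d)" for x y
  proof -
    have 1: "J y = J (x + 1 *\<^sub>R (y - x))" by simp
    have 2: "J (x + (1/2) *\<^sub>R (y - x)) \<ge> d" by (rule d_le)
    show ?thesis
      using 1 2 unfolding J_line norm_minus_commute[of x y]
      by (simp add: power2_eq_square field_simps)
  qed
  have "\<exists>x. J x < d + inverse (real (Suc n))" for n
    using cInf_lessD[of "range J" "d + inverse (real (Suc n))"] by (auto simp: d_def)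
  then obtain X where X: "\<And>n. J (X n) < d + inverse (real (Suc n))" by metis
  have dist_X: "(norm (X m - X n))\<^sup>2 \<le> 4 * inverse (real (Suc M))" if "m \<ge> M" "n \<ge> M" for m n M
  proof -
    have "J (X k) - d \<le> inverse (real (Suc M))" if "k \<ge> M" for k
    proof -
      have "inverse (real (Suc k)) \<le> inverse (real (Suc M))"
        using that by (intro le_imp_inverse_le) auto
      then have "J (X k) \<le> d + inverse (real (Suc M))"
        using X[of k] by (meson add_left_mono less_imp_le order_trans)
      then show ?thesis by (simp add: algebra_simps)
    qed
    from this[OF that(1)] this[OF that(2)] show ?thesis
      using midpoint[of "X m" "X n"] by argo
  qed
  have "Cauchy X"
  proof (rule metric_CauchyI)
    fix r :: real assume "r > 0"
    then obtain M where M: "inverse (real (Suc M)) < r\<^sup>2 / 4"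
      using reals_Archimedean[of "r\<^sup>2 / 4"] by auto
    have "dist (X m) (X n) < r" if "m \<ge> M" "n \<ge> M" for m n
    proof -
      have "(norm (X m - X n))\<^sup>2 < r\<^sup>2" using dist_X[OF that] M by linarith
      then show ?thesis using \<open>r > 0\<close> by (simp add: dist_norm power2_less_imp_less)
    qed
    then show "\<exists>M. \<forall>m\<ge>M. \<forall>n\<ge>M. dist (X m) (X n) < r" by blast
  qed
  then obtain y where y: "X \<longlonglongrightarrow> y" by (auto simp: Cauchy_convergent_iff convergent_def)
  have "(\<lambda>n. J (X n)) \<longlonglongrightarrow> J y"
    unfolding J_def by (intro tendsto_intros y bounded_linear.tendsto[OF bl])
  moreover have "(\<lambda>n. d + inverse (real (Suc n))) \<longlonglongrightarrow> d + 0"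
    by (intro tendsto_intros LIMSEQ_inverse_real_of_nat)
  ultimately have "J y \<le> d + 0"
    by (rule LIMSEQ_le) (use X less_imp_le in blast)
  then have min: "J y \<le> J x" for x using d_le[of x] by linarith
  have Re_eq: "Re (\<phi> x) = Re (cinner x y)" for x
  proof -
    define b where "b = 2 * (Re (cinner x y) - Re (\<phi> x))"
    define s where "s = (norm x)\<^sup>2 + 1"
    have s: "s > 0" "(norm x)\<^sup>2 < s" by (auto simp: s_def add_nonneg_pos)
    \<comment> \<open>A nonzero slope \<open>b\<close> at the minimum is refuted by a step of length \<open>- b / s\<close>, where the
      linear term beats the quadratic one.\<close>
    have ge: "0 \<le> t * b + t\<^sup>2 * (norm x)\<^sup>2" for t
      using min[of "y + t *\<^sub>R x"] unfolding J_line b_def by linarith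
    have "b = 0"
    proof (rule ccontr)
      assume "b \<noteq> 0"
      have "0 \<le> (- b / s) * b + (- b / s)\<^sup>2 * (norm x)\<^sup>2" by (rule ge)
      also have "(- b / s)\<^sup>2 * (norm x)\<^sup>2 < (- b / s)\<^sup>2 * s"
        using s \<open>b \<noteq> 0\<close> by (intro mult_strict_left_mono) auto
      also have "(- b / s) * b + (- b / s)\<^sup>2 * s = 0"
        using s by (simp add: power2_eq_square)
      finally show False by simp
    qed
    then show ?thesis by (simp add: b_def)
  qed
  have "\<phi> x = cinner x y" for x
  proof (rule complex_eqI)
    show "Im (\<phi> x) = Im (cinner x y)"
      using Re_eq[of "\<i> *\<^sub>C x"] by (simp add: lin cinner_scaleC_left)
  qed (rule Re_eq)
  then show ?thesis by blast
qed

lemma cinner_cadjoint: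
  fixes T :: "'a::chilbert_space \<Rightarrow> 'b::complex_inner"
  assumes "bounded_clinear T"
  shows "cinner (T x) y = cinner x (cadjoint T y)"
proof -
  note T = bounded_clinearD[OF assms]
  have "\<exists>z. \<forall>x. cinner (T x) y = cinner x z" for y
  proof (rule riesz_representation)
    fix x show "cmod (cinner (T x) y) \<le> (onorm T * norm y) * norm x"
      using norm_cinner_le_norm[of "T x" y] mult_right_mono[OF onorm[OF T(1), of x], of "norm y"]
      by (simp add: mult_ac)
  qed (auto simp: T cinner_add_left cinner_scaleC_left)
  then obtain T' where T': "\<And>x y. cinner (T x) y = cinner x (T' y)" by metis
  then show ?thesis using cadjoint_eqI[of T T'] by simp
qed

section \<open>Hankel operators with anticommuting coefficients\<close>

lemma sum_reflect:
  fixes f :: "int \<Rightarrow> 'a::comm_monoid_add"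
  assumes "finite W" "\<And>i. i \<notin> W \<Longrightarrow> f i = 0" "\<And>i. i \<notin> W \<Longrightarrow> f (s - i) = 0"
  shows "(\<Sum>i\<in>W. f (s - i)) = sum f W"
  by (rule sum.reindex_bij_witness_not_neutral
      [where S' = "{i\<in>W. f (s - i) = 0}" and T' = "{i\<in>W. f i = 0}" and i = "\<lambda>i. s - i" and j = "\<lambda>i. s - i"])
    (use assms in force)+

text \<open>Set \<open>v\<^sub>i = \<Sum>\<^sub>n \<beta>\<^sub>n C\<^sub>n h(n - i)\<close> and expand \<open>\<Sum>\<^sub>i \<parallel>v\<^sub>i\<parallel>\<^sup>2\<close> over pairs \<open>n, k\<close>. Replacing \<open>C\<^sub>k\<^sup>* C\<^sub>n\<close> by
  \<open>\<delta>\<^sub>n\<^sub>k - C\<^sub>n C\<^sub>k\<^sup>*\<close>, the \<open>\<delta>\<close> terms give exactly the right-hand side when \<open>i\<close> runs over all the integers. In the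
  remaining terms the substitution \<open>i \<mapsto> n + k - i\<close> turns \<open>h(n - i), h(k - i)\<close> into
  \<open>h(i - k), h(i - n)\<close>, so that each vector carries the index of the operator acting on it and the
  terms assemble to \<open>- \<Sum>\<^sub>i \<parallel>u\<^sub>i\<parallel>\<^sup>2\<close> with \<open>u\<^sub>i = \<Sum>\<^sub>k cnj \<beta>\<^sub>k C\<^sub>k\<^sup>* h(i - k)\<close>; these can be dropped. This
  substitution is the reason for indexing by the integers. The operators \<open>A n\<close> are the adjoints of
  the \<open>C n\<close>.\<close>

lemma car_hankel_int:
  fixes C A :: "nat \<Rightarrow> 'h::complex_inner \<Rightarrow> 'h" and \<beta> :: "nat \<Rightarrow> complex" and h :: "int \<Rightarrow> 'h"
  assumes lin: "\<And>n. bounded_clinear (C n)"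
    and adj: "\<And>n x y. cinner (C n x) y = cinner x (A n y)"
    and anti: "\<And>n k x. C n (A k x) + A k (C n x) = (if n = k then x else 0)"
    and supp: "\<And>t. t \<notin> J \<Longrightarrow> h t = 0"
    and fin: "finite I" "finite J" "finite P"
  shows "(\<Sum>i\<in>I. (norm (\<Sum>n\<in>P. \<beta> n *\<^sub>C C n (h (int n - i))))\<^sup>2)
     \<le> (\<Sum>n\<in>P. (cmod (\<beta> n))\<^sup>2) * (\<Sum>j\<in>J. (norm (h j))\<^sup>2)"
proof -
  \<comment> \<open>A finite window outside of which no \<open>h (n - i)\<close> or \<open>h (i - n)\<close> is nonzero, so that sums over
    it may be reflected freely.\<close>
  define W where "W = I \<union> (\<Union>n\<in>P. (\<lambda>t. int n - t) ` J) \<union> (\<Union>n\<in>P. (\<lambda>t. t + int n) ` J)"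
  have finW: "finite W" using fin by (auto simp: W_def)
  have out1: "h (int n - i) = 0" if "n \<in> P" "i \<notin> W" for n i
    using that supp[of "int n - i"] by (force simp: W_def image_iff)
  have out2: "h (i - int n) = 0" if "n \<in> P" "i \<notin> W" for n i
    using that supp[of "i - int n"] by (force simp: W_def image_iff)
  have A0: "A n 0 = 0" for n
    by (rule cinner_ext_right) (simp add: adj[symmetric])
  define v where "v i = (\<Sum>n\<in>P. \<beta> n *\<^sub>C C n (h (int n - i)))" for i
  define u where "u i = (\<Sum>k\<in>P. cnj (\<beta> k) *\<^sub>C A k (h (i - int k)))" for i
  define q where "q n k i = \<beta> n * cnj (\<beta> k) * cinner (A k (h (i - int k))) (A n (h (i - int n)))" for n k i
  have swap: "cinner (C n x) (C k y) = (if n = k then cinner x y else 0) - cinner (A k x) (A n y)" for n k x y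
  proof -
    have "cinner (C n x) (C k y) = cinner (A k (C n x)) y"
      by (metis adj cinner_commute)
    also have "A k (C n x) = (if n = k then x else 0) - C n (A k x)"
      using anti[of n k x] by (simp add: algebra_simps split: if_splits)
    finally show ?thesis by (simp add: cinner_minus_left adj)
  qed
  have vv: "cinner (v i) (v i) = (\<Sum>n\<in>P. complex_of_real ((cmod (\<beta> n))\<^sup>2 * (norm (h (int n - i)))\<^sup>2))
      - (\<Sum>n\<in>P. \<Sum>k\<in>P. q n k (int n + int k - i))" for i
  proof -
    have "cinner (v i) (v i) = (\<Sum>n\<in>P. \<Sum>k\<in>P. \<beta> n * cnj (\<beta> k) * cinner (C n (h (int n - i))) (C k (h (int k - i))))"
      by (simp add: v_def cinner_sum_left cinner_sum_right cinner_scaleC_left cinner_scaleC_right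
          mult_ac sum_distrib_left)
        (rule sum.swap)
    also have "\<dots> = (\<Sum>n\<in>P. \<Sum>k\<in>P. (if k = n then complex_of_real ((cmod (\<beta> n))\<^sup>2 * (norm (h (int n - i)))\<^sup>2) else 0)
        - q n k (int n + int k - i))"
      by (intro sum.cong refl)
        (auto simp: swap q_def algebra_simps cinner_self complex_norm_square simp del: of_real_power)
    also have "\<dots> = (\<Sum>n\<in>P. complex_of_real ((cmod (\<beta> n))\<^sup>2 * (norm (h (int n - i)))\<^sup>2))
      - (\<Sum>n\<in>P. \<Sum>k\<in>P. q n k (int n + int k - i))"
      using fin by (simp add: sum_subtractf)
    finally show ?thesis .
  qed
  have "(\<Sum>i\<in>W. \<Sum>n\<in>P. \<Sum>k\<in>P. q n k (int n + int k - i))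
      = (\<Sum>n\<in>P. \<Sum>k\<in>P. \<Sum>i\<in>W. q n k (int n + int k - i))"
    by (subst sum.swap) (intro sum.cong refl sum.swap)
  also have "\<dots> = (\<Sum>n\<in>P. \<Sum>k\<in>P. \<Sum>i\<in>W. q n k i)"
    by (intro sum.cong refl sum_reflect finW)
      (auto simp: q_def out1 out2 A0 algebra_simps)
  also have "\<dots> = (\<Sum>i\<in>W. \<Sum>n\<in>P. \<Sum>k\<in>P. q n k i)"
    by (subst (2) sum.swap) (intro sum.cong refl sum.swap)
  also have "\<dots> = (\<Sum>i\<in>W. cinner (u i) (u i))"
    by (simp add: u_def q_def cinner_sum_left cinner_sum_right cinner_scaleC_left cinner_scaleC_right
          mult_ac sum_distrib_left)
  finally have Q: "(\<Sum>i\<in>W. \<Sum>n\<in>P. \<Sum>k\<in>P. q n k (int n + int k - i)) = (\<Sum>i\<in>W. cinner (u i) (u i))" .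
  have "complex_of_real (\<Sum>i\<in>W. (norm (v i))\<^sup>2) = (\<Sum>i\<in>W. cinner (v i) (v i))"
    by (simp add: cinner_self)
  also have "\<dots> = complex_of_real ((\<Sum>i\<in>W. \<Sum>n\<in>P. (cmod (\<beta> n))\<^sup>2 * (norm (h (int n - i)))\<^sup>2)
      - (\<Sum>i\<in>W. (norm (u i))\<^sup>2))"
    by (simp add: vv sum_subtractf Q) (simp add: cinner_self)
  finally have "(\<Sum>i\<in>W. (norm (v i))\<^sup>2) = (\<Sum>i\<in>W. \<Sum>n\<in>P. (cmod (\<beta> n))\<^sup>2 * (norm (h (int n - i)))\<^sup>2)
      - (\<Sum>i\<in>W. (norm (u i))\<^sup>2)"
    unfolding of_real_eq_iff .
  also have "\<dots> \<le> (\<Sum>i\<in>W. \<Sum>n\<in>P. (cmod (\<beta> n))\<^sup>2 * (norm (h (int n - i)))\<^sup>2)"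
    by (simp add: sum_nonneg)
  also have "\<dots> = (\<Sum>n\<in>P. (cmod (\<beta> n))\<^sup>2 * (\<Sum>i\<in>W. (norm (h (int n - i)))\<^sup>2))"
    by (subst sum.swap) (simp add: sum_distrib_left)
  also have "\<dots> \<le> (\<Sum>n\<in>P. (cmod (\<beta> n))\<^sup>2 * (\<Sum>j\<in>J. (norm (h j))\<^sup>2))"
  proof (intro sum_mono mult_left_mono)
    fix n
    have "(\<Sum>i\<in>W. (norm (h (int n - i)))\<^sup>2) = (\<Sum>j\<in>(\<lambda>i. int n - i) ` W. (norm (h j))\<^sup>2)"
      by (subst sum.reindex) (auto simp: inj_on_def)
    also have "\<dots> = (\<Sum>j\<in>(\<lambda>i. int n - i) ` W \<inter> J. (norm (h j))\<^sup>2)"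
      by (rule sum.mono_neutral_right) (use finW supp in auto)
    also have "\<dots> \<le> (\<Sum>j\<in>J. (norm (h j))\<^sup>2)"
      by (rule sum_mono2) (use fin in auto)
    finally show "(\<Sum>i\<in>W. (norm (h (int n - i)))\<^sup>2) \<le> (\<Sum>j\<in>J. (norm (h j))\<^sup>2)" .
  qed auto
  also have "\<dots> = (\<Sum>n\<in>P. (cmod (\<beta> n))\<^sup>2) * (\<Sum>j\<in>J. (norm (h j))\<^sup>2)"
    by (simp add: sum_distrib_right)
  finally have "(\<Sum>i\<in>W. (norm (v i))\<^sup>2) \<le> (\<Sum>n\<in>P. (cmod (\<beta> n))\<^sup>2) * (\<Sum>j\<in>J. (norm (h j))\<^sup>2)" .
  moreover have "(\<Sum>i\<in>I. (norm (v i))\<^sup>2) \<le> (\<Sum>i\<in>W. (norm (v i))\<^sup>2)"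
    by (rule sum_mono2) (use finW in \<open>auto simp: W_def\<close>)
  ultimately show ?thesis unfolding v_def by linarith
qed


text \<open>Columns \<open>j \<ge> p\<close> only meet the coefficients \<open>\<alpha>\<^sub>n\<close> with \<open>n \<ge> p\<close>, so the bound is a tail of
  \<open>\<Sum>\<^sub>n |\<alpha>\<^sub>n|\<^sup>2\<close>. Replacing \<open>\<alpha>\<close> by its tail changes nothing on the columns in \<open>J\<close>.\<close>

lemma car_hankel_section:
  fixes C A :: "nat \<Rightarrow> 'h::complex_inner \<Rightarrow> 'h" and \<alpha> :: "nat \<Rightarrow> complex" and h :: "nat \<Rightarrow> 'h"
  assumes car: "\<And>n. bounded_clinear (C n)"
    "\<And>n x y. cinner (C n x) y = cinner x (A n y)"
    "\<And>n k x. C n (A k x) + A k (C n x) = (if n = k then x else 0)"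
    and fin: "finite J" and low: "\<And>j. j \<in> J \<Longrightarrow> p \<le> j" and high: "\<And>j. j \<in> J \<Longrightarrow> a + j \<le> N"
  shows "(\<Sum>i<a. (norm (\<Sum>j\<in>J. \<alpha> (i + j) *\<^sub>C C (i + j) (h j)))\<^sup>2)
     \<le> (\<Sum>n\<in>{p..<N}. (cmod (\<alpha> n))\<^sup>2) * (\<Sum>j\<in>J. (norm (h j))\<^sup>2)"
proof -
  define g where "g t = (if t \<in> int ` J then h (nat t) else 0)" for t
  have C0: "C n 0 = 0" for n by (rule bounded_clinearD[OF car(1)])
  have "(\<Sum>n\<in>{p..<N}. \<alpha> n *\<^sub>C C n (g (int n - int i))) = (\<Sum>j\<in>J. \<alpha> (i + j) *\<^sub>C C (i + j) (h j))"
    if "i < a" for i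
  proof -
    have sub: "(\<lambda>j. i + j) ` J \<subseteq> {p..<N}"
      using low high that by fastforce
    have "(\<Sum>n\<in>{p..<N}. \<alpha> n *\<^sub>C C n (g (int n - int i)))
        = (\<Sum>n\<in>(\<lambda>j. i + j) ` J. \<alpha> n *\<^sub>C C n (g (int n - int i)))"
    proof (rule sum.mono_neutral_right[OF _ sub], simp, intro ballI)
      fix n assume "n \<in> {p..<N} - (\<lambda>j. i + j) ` J"
      then have "int n - int i \<notin> int ` J" by (auto simp: image_iff)
      then show "\<alpha> n *\<^sub>C C n (g (int n - int i)) = 0" by (simp add: g_def C0)
    qed
    also have "\<dots> = (\<Sum>j\<in>J. \<alpha> (i + j) *\<^sub>C C (i + j) (h j))"
      by (subst sum.reindex) (auto simp: g_def inj_on_def)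
    finally show ?thesis .
  qed
  then have "(\<Sum>i<a. (norm (\<Sum>j\<in>J. \<alpha> (i + j) *\<^sub>C C (i + j) (h j)))\<^sup>2)
      = (\<Sum>i<a. (norm (\<Sum>n\<in>{p..<N}. \<alpha> n *\<^sub>C C n (g (int n - int i))))\<^sup>2)"
    by simp
  also have "\<dots> = (\<Sum>i\<in>int ` {..<a}. (norm (\<Sum>n\<in>{p..<N}. \<alpha> n *\<^sub>C C n (g (int n - i))))\<^sup>2)"
    by (subst sum.reindex) auto
  also have "\<dots> \<le> (\<Sum>n\<in>{p..<N}. (cmod (\<alpha> n))\<^sup>2) * (\<Sum>j\<in>int ` J. (norm (g j))\<^sup>2)"
    by (rule car_hankel_int[OF car]) (use fin in \<open>auto simp: g_def\<close>)
  also have "(\<Sum>j\<in>int ` J. (norm (g j))\<^sup>2) = (\<Sum>j\<in>J. (norm (h j))\<^sup>2)"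
    by (subst sum.reindex) (auto simp: g_def)
  finally show ?thesis .
qed

section \<open>Dyadic blocks of columns\<close>

lemma L2_set_norm_sum_le:
  fixes v :: "'b \<Rightarrow> 'i \<Rightarrow> 'a::real_normed_vector"
  shows "L2_set (\<lambda>i. norm (\<Sum>m\<in>B. v m i)) I \<le> (\<Sum>m\<in>B. L2_set (\<lambda>i. norm (v m i)) I)"
proof (induction B rule: infinite_finite_induct)
  case (insert m B)
  have "L2_set (\<lambda>i. norm (\<Sum>m\<in>insert m B. v m i)) I
      \<le> L2_set (\<lambda>i. norm (v m i) + norm (\<Sum>m\<in>B. v m i)) I"
    by (intro L2_set_mono) (use insert in \<open>auto simp: norm_triangle_ineq\<close>)
  also have "\<dots> \<le> L2_set (\<lambda>i. norm (v m i)) I + L2_set (\<lambda>i. norm (\<Sum>m\<in>B. v m i)) I"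
    by (rule L2_set_triangle_ineq)
  finally show ?case using insert by simp
qed (auto simp: L2_set_def)

text \<open>The sum is geometric and hence comparable to its last term, which is at most \<open>4 x\<^sup>2\<close>; the
  constant \<open>6\<close> rounds up \<open>4 \<cdot> 4 / 3\<close>.\<close>

lemma sum_dyadic_le:
  fixes x :: nat
  assumes "finite B" "x > 0"
  shows "(\<Sum>m | m \<in> B \<and> 2 ^ m \<le> x. 4 ^ (m + 1)) \<le> 6 * (real x)\<^sup>2"
proof -
  define k where "k = floor_log x"
  have geom: "3 * (\<Sum>m\<le>k. 4 ^ (m + 1)) + 4 = 16 * (4::real) ^ k" for k
    by (induction k) (auto simp: algebra_simps)
  have "m \<le> k" if "2 ^ m \<le> x" for m
    using floor_log_le_iff[of "2 ^ m" x] floor_log_mono that unfolding k_def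
    by (metis floor_log_power monoD)
  then have "(\<Sum>m | m \<in> B \<and> 2 ^ m \<le> x. 4 ^ (m + 1)) \<le> (\<Sum>m\<le>k. (4::real) ^ (m + 1))"
    by (intro sum_mono2) auto
  also have "\<dots> \<le> 6 * 4 ^ k" using geom[of k] zero_le_power[of "4::real" k] by argo
  also have "(4::real) ^ k = (real (2 ^ k))\<^sup>2"
    by (simp add: power2_eq_square power_mult_distrib[symmetric])
  also have "\<dots> \<le> (real x)\<^sup>2"
    using floor_log_exp2_le[OF assms(2)] unfolding k_def by (intro power_mono of_nat_mono) auto
  finally show ?thesis by simp
qed

text \<open>On the block of columns \<open>2\<^sup>m \<le> j + 1 < 2\<^sup>m\<^sup>+\<^sup>1\<close> the weight is at most \<open>2\<^sup>m\<^sup>+\<^sup>1\<close> and only the tail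
  \<open>T\<^sub>m = \<Sum>\<^sub>n |\<alpha>\<^sub>n|\<^sup>2\<close> over \<open>n + 1 \<ge> 2\<^sup>m\<close> enters. The triangle inequality over the blocks loses
  nothing essential: the blocks act on disjoint parts of \<open>h\<close>, so Cauchy-Schwarz recovers
  \<open>\<Sum>\<^sub>j \<parallel>h\<^sub>j\<parallel>\<^sup>2\<close> and leaves \<open>\<Sum>\<^sub>m 4\<^sup>m\<^sup>+\<^sup>1 T\<^sub>m\<close>. Interchanging the sums there produces the weight
  \<open>(n + 1)\<^sup>2\<close>.\<close>

lemma weighted_car_hankel_section:
  fixes C A :: "nat \<Rightarrow> 'h::complex_inner \<Rightarrow> 'h" and \<alpha> :: "nat \<Rightarrow> complex" and h :: "nat \<Rightarrow> 'h"
  assumes car: "\<And>n. bounded_clinear (C n)"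
    "\<And>n x y. cinner (C n x) y = cinner x (A n y)"
    "\<And>n k x. C n (A k x) + A k (C n x) = (if n = k then x else 0)"
    and fin: "finite J"
    and sm: "summable (\<lambda>n. (real n + 1)\<^sup>2 * (cmod (\<alpha> n))\<^sup>2)"
  shows "(\<Sum>i<a. (norm (\<Sum>j\<in>J. \<alpha> (i + j) *\<^sub>C C (i + j) (real (j + 1) *\<^sub>R h j)))\<^sup>2)
     \<le> 6 * (\<Sum>n. (real n + 1)\<^sup>2 * (cmod (\<alpha> n))\<^sup>2) * (\<Sum>j\<in>J. (norm (h j))\<^sup>2)"
proof -
  obtain N where N: "\<And>j. j \<in> J \<Longrightarrow> a + j \<le> N"
  proof
    fix j assume "j \<in> J" then show "a + j \<le> a + Max J" using fin by simp
  qed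
  define b where "b j = floor_log (Suc j)" for j
  define Jm where "Jm m = {j \<in> J. b j = m}" for m
  define v where "v m i = (\<Sum>j\<in>Jm m. \<alpha> (i + j) *\<^sub>C C (i + j) (real (j + 1) *\<^sub>R h j))" for m i
  define T where "T m = (\<Sum>n\<in>{2 ^ m - 1..<N}. (cmod (\<alpha> n))\<^sup>2)" for m :: nat
  define H where "H m = (\<Sum>j\<in>Jm m. (norm (h j))\<^sup>2)" for m
  have T0: "T m \<ge> 0" and H0: "H m \<ge> 0" for m by (auto simp: T_def H_def sum_nonneg)
  have group: "sum f J = (\<Sum>m\<in>b ` J. sum f (Jm m))" for f :: "nat \<Rightarrow> 'c::comm_monoid_add"
    unfolding Jm_def by (rule sum.image_gen[OF fin])
  have block: "L2_set (\<lambda>i. norm (v m i)) {..<a} \<le> sqrt (4 ^ (m + 1) * T m) * sqrt (H m)" for m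
  proof -
    have "(\<Sum>i<a. (norm (v m i))\<^sup>2) \<le> T m * (\<Sum>j\<in>Jm m. (norm (real (j + 1) *\<^sub>R h j))\<^sup>2)"
      unfolding v_def T_def
    proof (rule car_hankel_section[OF car])
      fix j assume "j \<in> Jm m"
      then show "2 ^ m - 1 \<le> j"
        using floor_log_exp2_le[of "Suc j"] by (auto simp: Jm_def b_def)
    qed (use fin N in \<open>auto simp: Jm_def\<close>)
    also have "\<dots> \<le> T m * (\<Sum>j\<in>Jm m. 4 ^ (m + 1) * (norm (h j))\<^sup>2)"
    proof (intro mult_left_mono[OF _ T0] sum_mono)
      fix j assume "j \<in> Jm m"
      then have "j + 1 \<le> 2 ^ (m + 1)"
        using floor_log_exp2_gt[of "Suc j"] by (auto simp: Jm_def b_def)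
      then have "real (j + 1) \<le> 2 ^ (m + 1)"
        by (metis of_nat_le_iff of_nat_numeral of_nat_power)
      then have "(real (j + 1))\<^sup>2 \<le> (2 ^ (m + 1))\<^sup>2" by (intro power_mono) auto
      also have "((2::real) ^ (m + 1))\<^sup>2 = 4 ^ (m + 1)"
        by (simp add: power2_eq_square power_mult_distrib[symmetric])
      finally show "(norm (real (j + 1) *\<^sub>R h j))\<^sup>2 \<le> 4 ^ (m + 1) * (norm (h j))\<^sup>2"
        by (simp add: power_mult_distrib mult_right_mono)
    qed
    also have "\<dots> = 4 ^ (m + 1) * T m * H m"
      by (simp add: H_def sum_distrib_left mult_ac)
    finally show ?thesis
      unfolding L2_set_def real_sqrt_mult[symmetric] by (rule real_sqrt_le_mono)
  qed
  have "(\<Sum>m\<in>b ` J. 4 ^ (m + 1) * T m)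
      = (\<Sum>m\<in>b ` J. \<Sum>n<N. if 2 ^ m \<le> Suc n then 4 ^ (m + 1) * (cmod (\<alpha> n))\<^sup>2 else 0)"
  proof (rule sum.cong[OF refl])
    fix m
    have "{2 ^ m - 1..<N} = {n \<in> {..<N}. 2 ^ m \<le> Suc n}" by auto
    then have "T m = (\<Sum>n<N. if 2 ^ m \<le> Suc n then (cmod (\<alpha> n))\<^sup>2 else 0)"
      unfolding T_def by (simp only: sum.inter_filter[OF finite_lessThan])
    then show "4 ^ (m + 1) * T m = (\<Sum>n<N. if 2 ^ m \<le> Suc n then 4 ^ (m + 1) * (cmod (\<alpha> n))\<^sup>2 else 0)"
      by (simp add: sum_distrib_left if_distrib cong: if_cong)
  qed
  also have "\<dots> = (\<Sum>n<N. \<Sum>m\<in>b ` J. if 2 ^ m \<le> Suc n then 4 ^ (m + 1) * (cmod (\<alpha> n))\<^sup>2 else 0)"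
    by (rule sum.swap)
  also have "\<dots> = (\<Sum>n<N. (\<Sum>m | m \<in> b ` J \<and> 2 ^ m \<le> Suc n. 4 ^ (m + 1)) * (cmod (\<alpha> n))\<^sup>2)"
    using fin by (simp add: sum.inter_filter[symmetric] sum_distrib_right)
  also have "\<dots> \<le> (\<Sum>n<N. 6 * (real (Suc n))\<^sup>2 * (cmod (\<alpha> n))\<^sup>2)"
    by (intro sum_mono mult_right_mono sum_dyadic_le) (use fin in auto)
  also have "\<dots> = 6 * (\<Sum>n<N. (real n + 1)\<^sup>2 * (cmod (\<alpha> n))\<^sup>2)"
    by (simp add: sum_distrib_left mult_ac add.commute)
  also have "\<dots> \<le> 6 * (\<Sum>n. (real n + 1)\<^sup>2 * (cmod (\<alpha> n))\<^sup>2)"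
    by (intro mult_left_mono sum_le_suminf sm) auto
  finally have total: "(\<Sum>m\<in>b ` J. 4 ^ (m + 1) * T m) \<le> 6 * (\<Sum>n. (real n + 1)\<^sup>2 * (cmod (\<alpha> n))\<^sup>2)" .
  have "L2_set (\<lambda>i. norm (\<Sum>m\<in>b ` J. v m i)) {..<a}
      \<le> (\<Sum>m\<in>b ` J. L2_set (\<lambda>i. norm (v m i)) {..<a})"
    by (rule L2_set_norm_sum_le)
  also have "\<dots> \<le> (\<Sum>m\<in>b ` J. \<bar>sqrt (4 ^ (m + 1) * T m)\<bar> * \<bar>sqrt (H m)\<bar>)"
    by (intro sum_mono order_trans[OF block]) (auto simp: T0 H0)
  also have "\<dots> \<le> L2_set (\<lambda>m. sqrt (4 ^ (m + 1) * T m)) (b ` J) * L2_set (\<lambda>m. sqrt (H m)) (b ` J)"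
    by (rule L2_set_mult_ineq)
  also have "\<dots> = sqrt (\<Sum>m\<in>b ` J. 4 ^ (m + 1) * T m) * sqrt (\<Sum>m\<in>b ` J. H m)"
    by (simp only: L2_set_def real_sqrt_pow2 T0 H0 mult_nonneg_nonneg zero_le_power zero_le_numeral)
  finally have "L2_set (\<lambda>i. norm (\<Sum>m\<in>b ` J. v m i)) {..<a}
      \<le> sqrt ((\<Sum>m\<in>b ` J. 4 ^ (m + 1) * T m) * (\<Sum>m\<in>b ` J. H m))"
    by (simp only: real_sqrt_mult)
  then have "(\<Sum>i<a. (norm (\<Sum>m\<in>b ` J. v m i))\<^sup>2)
      \<le> (\<Sum>m\<in>b ` J. 4 ^ (m + 1) * T m) * (\<Sum>m\<in>b ` J. H m)"
    unfolding L2_set_def real_sqrt_le_iff .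
  also have "\<dots> \<le> 6 * (\<Sum>n. (real n + 1)\<^sup>2 * (cmod (\<alpha> n))\<^sup>2) * (\<Sum>m\<in>b ` J. H m)"
    by (intro mult_right_mono total sum_nonneg H0)
  finally show ?thesis by (simp only: v_def H_def group)
qed

section \<open>Bounded operator matrices\<close>

text \<open>A bound that is uniform over finitely many columns and the first \<open>a\<close> rows controls the whole
  matrix: applied to late columns it makes the rows Cauchy, and it survives the limit over the
  columns and then over \<open>a\<close>.\<close>

lemma matrix_op_bounded:
  fixes X :: "nat \<Rightarrow> nat \<Rightarrow> 'h::chilbert_space \<Rightarrow> 'h"
  assumes lin: "\<And>i j. bounded_clinear (X i j)" and K: "K \<ge> 0"
    and bound: "\<And>h a J. finite J \<Longrightarrow>
      (\<Sum>i<a. (norm (\<Sum>j\<in>J. X i j (h j)))\<^sup>2) \<le> K * (\<Sum>j\<in>J. (norm (h j))\<^sup>2)"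
  shows "matrix_acts X" and "bounded_clinear (matrix_op X)"
    and "summable (\<lambda>j. X i j (seq h j))"
    and "seq (matrix_op X h) i = (\<Sum>j. X i j (seq h j))"
proof -
  note X = bounded_clinearD[OF lin]
  have sm: "summable (\<lambda>j. X i j (seq h j))" for i h
  proof (subst summable_Cauchy, intro allI impI)
    fix r :: real assume r: "r > 0"
    then have "r\<^sup>2 / (K + 1) > 0" using K by simp
    then obtain N where N: "\<And>m n. m \<ge> N \<Longrightarrow> norm (\<Sum>j\<in>{m..<n}. (norm (seq h j))\<^sup>2) < r\<^sup>2 / (K + 1)"
      using summable_seq[of h] unfolding summable_Cauchy by meson
    have "norm (\<Sum>j\<in>{m..<n}. X i j (seq h j)) < r" if "m \<ge> N" for m n
    proof -
      have "(norm (\<Sum>j\<in>{m..<n}. X i j (seq h j)))\<^sup>2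
          \<le> (\<Sum>i<Suc i. (norm (\<Sum>j\<in>{m..<n}. X i j (seq h j)))\<^sup>2)"
        by (simp add: sum_nonneg)
      also have "\<dots> \<le> K * (\<Sum>j\<in>{m..<n}. (norm (seq h j))\<^sup>2)" by (rule bound) simp
      also have "\<dots> \<le> (K + 1) * (\<Sum>j\<in>{m..<n}. (norm (seq h j))\<^sup>2)"
        by (intro mult_right_mono sum_nonneg) auto
      also have "\<dots> < (K + 1) * (r\<^sup>2 / (K + 1))"
        using N[OF that, of n] K by (intro mult_strict_left_mono) auto
      also have "\<dots> = r\<^sup>2" using K by simp
      finally show ?thesis using r by (simp add: power2_less_imp_less)
    qed
    then show "\<exists>N. \<forall>m\<ge>N. \<forall>n. norm (\<Sum>j\<in>{m..<n}. X i j (seq h j)) < r" by blast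
  qed
  have part: "(\<Sum>i<a. (norm (\<Sum>j. X i j (seq h j)))\<^sup>2) \<le> K * (norm h)\<^sup>2" for a h
  proof (rule LIMSEQ_le_const2)
    show "(\<lambda>n. \<Sum>i<a. (norm (\<Sum>j<n. X i j (seq h j)))\<^sup>2) \<longlonglongrightarrow> (\<Sum>i<a. (norm (\<Sum>j. X i j (seq h j)))\<^sup>2)"
      by (intro tendsto_intros summable_LIMSEQ sm)
    have "(\<Sum>i<a. (norm (\<Sum>j<n. X i j (seq h j)))\<^sup>2) \<le> K * (norm h)\<^sup>2" for n
      by (rule order_trans[OF bound mult_left_mono[OF sum_seq_le K]]) simp
    then show "\<exists>N. \<forall>n\<ge>N. (\<Sum>i<a. (norm (\<Sum>j<n. X i j (seq h j)))\<^sup>2) \<le> K * (norm h)\<^sup>2" by blast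
  qed
  have sq: "summable (\<lambda>i. (norm (\<Sum>j. X i j (seq h j)))\<^sup>2)" for h
    by (rule summableI_nonneg_bounded[OF _ part]) simp
  show "matrix_acts X" using sm sq by (simp add: matrix_acts_def)
  show "summable (\<lambda>j. X i j (seq h j))" by (rule sm)
  have sq_op: "seq (matrix_op X h) i = (\<Sum>j. X i j (seq h j))" for h i
    using sq[of h] by (simp add: matrix_op_def Abs_ell2_inverse)
  then show "seq (matrix_op X h) i = (\<Sum>j. X i j (seq h j))" .
  show "bounded_clinear (matrix_op X)"
  proof (rule bounded_clinearI)
    fix g h :: "'h ell2"
    show "matrix_op X (g + h) = matrix_op X g + matrix_op X h"
      by (rule ell2_eqI) (simp add: sq_op plus_ell2.rep_eq X suminf_add sm)
  next
    fix c and h :: "'h ell2"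
    have "bounded_linear (\<lambda>x::'h. c *\<^sub>C x)"
      by (rule bounded_linear_intro[where K = "cmod c"])
        (auto simp: scaleC_add_right scaleR_scaleC scaleC_scaleC norm_scaleC mult.commute)
    then show "matrix_op X (c *\<^sub>C h) = c *\<^sub>C matrix_op X h"
      by (intro ell2_eqI) (simp add: sq_op scaleC_ell2.rep_eq X bounded_linear.suminf sm)
  next
    fix h :: "'h ell2"
    have "(\<Sum>i. (norm (\<Sum>j. X i j (seq h j)))\<^sup>2) \<le> K * (norm h)\<^sup>2"
      by (intro suminf_le_const sq part)
    then have "norm (matrix_op X h) \<le> sqrt (K * (norm h)\<^sup>2)"
      unfolding norm_ell2_def[of "matrix_op X h"] sq_op by (rule real_sqrt_le_mono)
    then show "norm (matrix_op X h) \<le> sqrt K * norm h"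
      by (simp add: real_sqrt_mult)
  qed
qed

section \<open>The shift and Foguel operators\<close>

lift_definition backshift :: "'h::real_normed_vector ell2 \<Rightarrow> 'h ell2" is "\<lambda>h n. h (Suc n)"
  by (subst summable_Suc_iff)

lemma seq_shift_0 [simp]: "seq (shift h) 0 = 0"
  and seq_shift_Suc [simp]: "seq (shift h) (Suc n) = seq h n"
  by (transfer, simp)+

lemma seq_backshift [simp]: "seq (backshift h) n = seq h (Suc n)"
  by transfer simp

lemma backshift_shift [simp]: "backshift (shift h) = h"
  by (rule ell2_eqI) simp

lemma norm_shift [simp]: "norm (shift h) = norm h"
  using suminf_split_head[OF summable_seq[of "shift h"]] by (simp add: norm_ell2_def)

lemma norm_backshift_le: "norm (backshift h) \<le> norm h"
  using suminf_split_head[OF summable_seq[of h]] by (simp add: norm_ell2_def)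

lemma bounded_clinear_shift: "bounded_clinear (shift :: 'h::complex_inner ell2 \<Rightarrow> 'h ell2)"
proof (rule bounded_clinearI[where K = 1])
  fix g h :: "'h ell2" and c
  show "shift (g + h) = shift g + shift h" "shift (c *\<^sub>C h) = c *\<^sub>C shift h"
    by (rule ell2_eqI, rename_tac n, case_tac n;
        simp add: plus_ell2.rep_eq scaleC_ell2.rep_eq)+
qed simp

lemma bounded_clinear_backshift: "bounded_clinear (backshift :: 'h::complex_inner ell2 \<Rightarrow> 'h ell2)"
proof (rule bounded_clinearI[where K = 1])
  fix g h :: "'h ell2" and c
  show "backshift (g + h) = backshift g + backshift h" "backshift (c *\<^sub>C h) = c *\<^sub>C backshift h"
    by (rule ell2_eqI, simp add: plus_ell2.rep_eq scaleC_ell2.rep_eq)+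
qed (simp add: norm_backshift_le)

lemma cadjoint_shift: "cadjoint shift = (backshift :: 'h::complex_inner ell2 \<Rightarrow> 'h ell2)"
proof (rule cadjoint_eqI)
  fix g h :: "'h ell2"
  show "cinner (shift g) h = cinner g (backshift h)"
    using suminf_split_head[OF summable_cinner_seq[of "shift g" h]] by (simp add: cinner_ell2_def)
qed

text \<open>With \<open>L\<close> the unipotent matrix with corner \<open>X\<close>, the corner of \<open>L\<^sup>-\<^sup>1 R(Y) L\<close> is
  \<open>S\<^sup>* X + Y - X S = 0\<close>, and \<open>S\<^sup>* \<oplus> S\<close> is a contraction.\<close>

lemma foguel_similar_to_contraction:
  fixes X Y :: "'h::chilbert_space ell2 \<Rightarrow> 'h ell2"
  assumes X: "bounded_clinear X" and Y: "\<And>h. Y h = X (shift h) - backshift (X h)"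
  shows "similar_to_contraction (foguel_op Y)"
proof -
  note bc = bounded_clinear_Pair bounded_clinear_add bounded_clinear_diff
    bounded_clinear_fst bounded_clinear_snd bounded_clinear_compose[OF X]
    bounded_clinear_compose[OF bounded_clinear_shift] bounded_clinear_compose[OF bounded_clinear_backshift]
  define L where "L p = (fst p + X (snd p), snd p)" for p
  define L' where "L' p = (fst p - X (snd p), snd p)" for p
  have foguel: "foguel_op Y = (\<lambda>p. (backshift (fst p) + (X (shift (snd p)) - backshift (X (snd p))), shift (snd p)))"
    by (auto simp: foguel_op_def cadjoint_shift Y)
  have inv: "L \<circ> L' = id" "L' \<circ> L = id" by (auto simp: L_def L'_def)
  have "norm (L' (foguel_op Y (L (g, h)))) \<le> norm (g, h)" for g h
  proof -
    have "L' (foguel_op Y (L (g, h))) = (backshift g, shift h)"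
      by (simp add: L_def L'_def foguel bounded_clinearD[OF bounded_clinear_backshift])
    moreover have "(norm (backshift g))\<^sup>2 \<le> (norm g)\<^sup>2"
      by (intro power_mono norm_backshift_le) simp
    ultimately show ?thesis by (simp add: norm_Pair)
  qed
  then have "onorm (L' \<circ> foguel_op Y \<circ> L) \<le> 1"
    by (intro onorm_bound) auto
  moreover have "bounded_clinear L" "bounded_clinear L'" "bounded_clinear (foguel_op Y)"
    unfolding foguel L_def[abs_def] L'_def[abs_def] by (intro bc)+
  ultimately show ?thesis
    unfolding similar_to_contraction_def using inv by blast
qed

section \<open>The similarity\<close>

lemma car_generators:
  fixes \<Lambda> :: "'h::chilbert_space \<Rightarrow> 'h \<Rightarrow> 'h"
  assumes "car_map \<Lambda>" "orthonormal_basis e"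
  shows "bounded_clinear (\<Lambda> (e n))"
    "cinner (\<Lambda> (e n) x) y = cinner x (cadjoint (\<Lambda> (e n)) y)"
    "\<Lambda> (e n) (cadjoint (\<Lambda> (e k)) x) + cadjoint (\<Lambda> (e k)) (\<Lambda> (e n) x) = (if n = k then x else 0)"
  using assms by (auto simp: car_map_def orthonormal_basis_def scaleC_one cinner_cadjoint)

text \<open>The solution of the commutator equation is \<open>X = Z S\<^sup>*\<close>. Then \<open>X S = Z\<close>, and \<open>S\<^sup>* X\<close> has the
  entries \<open>j \<alpha>\<^sub>i\<^sub>+\<^sub>j C\<^sub>i\<^sub>+\<^sub>j\<close>, which differ from \<open>(j + 1) \<alpha>\<^sub>i\<^sub>+\<^sub>j C\<^sub>i\<^sub>+\<^sub>j\<close> by those of \<open>Y\<close>.\<close>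

lemma car_foguel_hankel_similar_to_contraction:
  fixes \<Lambda> :: "'h::chilbert_space \<Rightarrow> 'h \<Rightarrow> 'h"
  assumes car: "car_map \<Lambda>" and basis: "orthonormal_basis e"
    and sm: "summable (\<lambda>n. (real n + 1)\<^sup>2 * (cmod (\<alpha> n))\<^sup>2)"
  shows "matrix_acts (car_hankel_matrix \<Lambda> e \<alpha>)"
    and "similar_to_contraction (foguel_op (matrix_op (car_hankel_matrix \<Lambda> e \<alpha>)))"
proof -
  note gen = car_generators[OF car basis]
  note gen_lin = bounded_clinearD[OF gen(1)]
  define s where "s = (\<Sum>n. (real n + 1)\<^sup>2 * (cmod (\<alpha> n))\<^sup>2)"
  define Y where "Y = car_hankel_matrix \<Lambda> e \<alpha>"
  define Z where "Z i j x = \<alpha> (i + j) *\<^sub>C \<Lambda> (e (i + j)) (real (j + 1) *\<^sub>R x)" for i j x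
  have s0: "0 \<le> s" unfolding s_def by (intro suminf_nonneg sm) auto
  have linscale: "bounded_clinear (\<lambda>x::'h. c *\<^sub>C x)" for c
    by (rule bounded_clinearI[where K = "cmod c"])
      (auto simp: scaleC_add_right scaleC_scaleC norm_scaleC mult.commute)
  have Y_lin: "bounded_clinear (Y i j)" for i j
    unfolding Y_def car_hankel_matrix_def by (intro bounded_clinear_compose[OF linscale] gen)
  have Z_lin: "bounded_clinear (Z i j)" for i j
    unfolding Z_def[abs_def] scaleR_scaleC
    by (intro bounded_clinear_compose[OF linscale] bounded_clinear_compose[OF gen(1)] linscale)
  have Z_eq: "Z i j x = real (j + 1) *\<^sub>R Y i j x" for i j x
    unfolding Z_def Y_def car_hankel_matrix_def scaleR_scaleC gen_lin
    by (simp add: scaleC_scaleC mult.commute)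
  have Z_bound: "(\<Sum>i<a. (norm (\<Sum>j\<in>J. Z i j (h j)))\<^sup>2) \<le> 6 * s * (\<Sum>j\<in>J. (norm (h j))\<^sup>2)"
    if "finite J" for a J h
    unfolding Z_def s_def by (rule weighted_car_hankel_section[OF gen that sm])
  have Y_bound: "(\<Sum>i<a. (norm (\<Sum>j\<in>J. Y i j (h j)))\<^sup>2) \<le> s * (\<Sum>j\<in>J. (norm (h j))\<^sup>2)"
    if "finite J" for a J h
  proof -
    have "(\<Sum>i<a. (norm (\<Sum>j\<in>J. Y i j (h j)))\<^sup>2)
        \<le> (\<Sum>n\<in>{0..<a + Max J}. (cmod (\<alpha> n))\<^sup>2) * (\<Sum>j\<in>J. (norm (h j))\<^sup>2)"
      unfolding Y_def car_hankel_matrix_def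
      by (rule car_hankel_section[OF gen]) (use that in auto)
    also have "\<dots> \<le> s * (\<Sum>j\<in>J. (norm (h j))\<^sup>2)"
    proof (intro mult_right_mono sum_nonneg)
      have "(\<Sum>n\<in>{0..<a + Max J}. (cmod (\<alpha> n))\<^sup>2)
          \<le> (\<Sum>n\<in>{0..<a + Max J}. (real n + 1)\<^sup>2 * (cmod (\<alpha> n))\<^sup>2)"
        by (intro sum_mono) (simp add: mult_le_cancel_right1 one_le_power)
      also have "\<dots> \<le> s" unfolding s_def by (intro sum_le_suminf sm) auto
      finally show "(\<Sum>n\<in>{0..<a + Max J}. (cmod (\<alpha> n))\<^sup>2) \<le> s" .
    qed auto
    finally show ?thesis .
  qed
  have s6: "0 \<le> 6 * s" using s0 by simp
  have Yop: "matrix_acts Y" "\<And>i h. summable (\<lambda>j. Y i j (seq h j))"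
    "\<And>i h. seq (matrix_op Y h) i = (\<Sum>j. Y i j (seq h j))"
    by (rule matrix_op_bounded[OF Y_lin s0 Y_bound]; assumption)+
  have Zop: "bounded_clinear (matrix_op Z)" "\<And>i h. summable (\<lambda>j. Z i j (seq h j))"
    "\<And>i h. seq (matrix_op Z h) i = (\<Sum>j. Z i j (seq h j))"
    by (rule matrix_op_bounded[OF Z_lin s6 Z_bound]; assumption)+
  show "matrix_acts (car_hankel_matrix \<Lambda> e \<alpha>)" using Yop(1) by (simp add: Y_def)
  have "similar_to_contraction (foguel_op (matrix_op Y))"
  proof (rule foguel_similar_to_contraction)
    show "bounded_clinear (\<lambda>h. matrix_op Z (backshift h))"
      by (rule bounded_clinear_compose[OF Zop(1) bounded_clinear_backshift])
    fix h :: "'h ell2"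
    show "matrix_op Y h = matrix_op Z (backshift (shift h)) - backshift (matrix_op Z (backshift h))"
    proof (rule ell2_eqI)
      fix i
      have shifted: "(\<lambda>j. Z (Suc i) j (seq (backshift h) j)) = (\<lambda>j. real (Suc j) *\<^sub>R Y i (Suc j) (seq h (Suc j)))"
        by (auto simp: Z_eq Y_def car_hankel_matrix_def)
      have sm1: "summable (\<lambda>j. real (Suc j) *\<^sub>R Y i (Suc j) (seq h (Suc j)))"
        using Zop(2)[of "Suc i" "backshift h"] unfolding shifted .
      then have sm0: "summable (\<lambda>j. real j *\<^sub>R Y i j (seq h j))"
        using summable_Suc_iff[of "\<lambda>j. real j *\<^sub>R Y i j (seq h j)"] by simp
      have "seq (matrix_op Z (backshift h)) (Suc i) = (\<Sum>j. Z (Suc i) j (seq (backshift h) j))"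
        by (rule Zop)
      also have "\<dots> = (\<Sum>j. real j *\<^sub>R Y i j (seq h j))"
        using suminf_split_head[OF sm0] unfolding shifted by simp
      finally have "seq (matrix_op Z (backshift h)) (Suc i) = (\<Sum>j. real j *\<^sub>R Y i j (seq h j))" .
      moreover have "seq (matrix_op Z h) i = (\<Sum>j. Y i j (seq h j)) + (\<Sum>j. real j *\<^sub>R Y i j (seq h j))"
        unfolding Zop(3) suminf_add[OF Yop(2) sm0] by (simp add: Z_eq algebra_simps)
      ultimately show "seq (matrix_op Y h) i
          = seq (matrix_op Z (backshift (shift h)) - backshift (matrix_op Z (backshift h))) i"
        by (simp add: minus_ell2.rep_eq Yop(3))
    qed
  qed
  then show "similar_to_contraction (foguel_op (matrix_op (car_hankel_matrix \<Lambda> e \<alpha>)))"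
    by (simp add: Y_def)
qed

theorem corollary2p4:
  fixes \<Lambda> :: "'h::chilbert_space \<Rightarrow> 'h \<Rightarrow> 'h"
    and e :: "nat \<Rightarrow> 'h"
    and \<alpha> :: "nat \<Rightarrow> complex"
    and \<epsilon> :: real
  assumes car: "car_map \<Lambda>"
    and basis: "orthonormal_basis e"
    and eps: "\<epsilon> > 0"
    and alpha_ell2: "summable (\<lambda>k. (cmod (\<alpha> k))\<^sup>2)"
    and weighted: "summable (\<lambda>k. (real k + 1)\<^sup>2 * (ln (real k + 1)) powr (2 + \<epsilon>) * (cmod (\<alpha> k))\<^sup>2)"
  shows "matrix_acts (car_hankel_matrix \<Lambda> e \<alpha>) \<and>
    similar_to_contraction (foguel_op (matrix_op (car_hankel_matrix \<Lambda> e \<alpha>)))"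
proof -
  have "summable (\<lambda>k. (real k + 1)\<^sup>2 * (cmod (\<alpha> k))\<^sup>2)"
    \<comment> \<open>The logarithm reaches \<open>1\<close> at \<open>k + 1 = 3\<close>, as \<open>exp 1 \<le> 3\<close>.\<close>
  proof (rule summable_comparison_test'[OF weighted, where N = 2])
    fix k :: nat assume "k \<ge> 2"
    then have "exp 1 \<le> real k + 1" using exp_le by simp
    then have "1 \<le> ln (real k + 1)" by (simp add: ln_ge_iff)
    then have "1 \<le> ln (real k + 1) powr (2 + \<epsilon>)" using eps by (simp add: ge_one_powr_ge_zero)
    then have "(real k + 1)\<^sup>2 * 1 \<le> (real k + 1)\<^sup>2 * ln (real k + 1) powr (2 + \<epsilon>)"
      by (intro mult_left_mono) auto
    then show "norm ((real k + 1)\<^sup>2 * (cmod (\<alpha> k))\<^sup>2)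
        \<le> (real k + 1)\<^sup>2 * ln (real k + 1) powr (2 + \<epsilon>) * (cmod (\<alpha> k))\<^sup>2"
      by (simp add: mult_right_mono)
  qed
  then show ?thesis using car_foguel_hankel_similar_to_contraction[OF car basis] by blast
qed

end
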